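(* Let $G$ be a graph and $r$ a positive integer. Then $\mathcal{R}(G)\cong K_r$ if and only if $G$ is a threshold graph in whose construction exactly $r-1$ vertices were added as universal vertices.
   Context: All graphs are finite, simple and undirected; $N(v)$ denotes the open neighbourhood of $v$. A set $S\subseteq V(G)$ is a dominating set if every vertex of $G$ is in $S$ or adjacent to a vertex of $S$; it is a minimal dominating set if no proper subset of $S$ is a dominating set. The reconfiguration graph $\mathcal{R}(G)$ has as vertex set the collection of all minimal dominating sets of $G$, and two minimal dominating sets $M_1,M_2$ are adjacent iff there is a vertex $v$ with either ($M_2\setminus M_1=\{v\}$ and $M_1\setminus M_2\subseteq N(v)$) or ($M_1\setminus M_2=\{v\}$ and $M_2\setminus M_1\subseteq N(v)$). A threshold graph is a graph obtained by starting from $K_1$ and repeatedly adding either an isolated vertex (adjacent to none of the existing vertices) or a universal vertex (adjacent to all existing vertices); the count "$r-1$ vertices added as universal vertices" refers to the number of additions of the second kind in such a construction. *)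

theory Defs
  imports "Graph_Theory.Graph_Theory"
begin

text \<open>
  A finite simple undirected graph is a \<open>pair_graph\<close>: a finite, loop-free, symmetric digraph whose
  arcs are pairs of vertices, so that an edge \<open>uv\<close> is represented by the two arcs \<open>(u, v)\<close>, \<open>(v, u)\<close>.
  On such graphs \<open>digraph_iso\<close> is graph isomorphism.
\<close>

definition open_nbhd :: "'a pair_pre_digraph \<Rightarrow> 'a \<Rightarrow> 'a set" where
  "open_nbhd G v = {u. (v, u) \<in> parcs G}"

definition dominating_set :: "'a pair_pre_digraph \<Rightarrow> 'a set \<Rightarrow> bool" where
  "dominating_set G S \<longleftrightarrow>
     S \<subseteq> pverts G \<and> (\<forall>v \<in> pverts G. v \<in> S \<or> (\<exists>u \<in> S. v \<in> open_nbhd G u))"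

definition minimal_dominating_set :: "'a pair_pre_digraph \<Rightarrow> 'a set \<Rightarrow> bool" where
  "minimal_dominating_set G S \<longleftrightarrow>
     dominating_set G S \<and> (\<forall>T. T \<subset> S \<longrightarrow> \<not> dominating_set G T)"

definition reconf_adj :: "'a pair_pre_digraph \<Rightarrow> 'a set \<Rightarrow> 'a set \<Rightarrow> bool" where
  "reconf_adj G M1 M2 \<longleftrightarrow>
     (\<exists>v. (M2 - M1 = {v} \<and> M1 - M2 \<subseteq> open_nbhd G v) \<or>
          (M1 - M2 = {v} \<and> M2 - M1 \<subseteq> open_nbhd G v))"

definition reconf_graph :: "'a pair_pre_digraph \<Rightarrow> 'a set pair_pre_digraph" where
  "reconf_graph G =
     \<lparr> pverts = {M. minimal_dominating_set G M},
       parcs = {(M1, M2). minimal_dominating_set G M1 \<and> minimal_dominating_set G M2 \<and>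
                          reconf_adj G M1 M2} \<rparr>"

definition complete_graph :: "nat \<Rightarrow> nat pair_pre_digraph" where
  "complete_graph r = \<lparr> pverts = {..<r}, parcs = {(i, j). i < r \<and> j < r \<and> i \<noteq> j} \<rparr>"

definition add_isolated :: "'a \<Rightarrow> 'a pair_pre_digraph \<Rightarrow> 'a pair_pre_digraph" where
  "add_isolated v G = \<lparr> pverts = insert v (pverts G), parcs = parcs G \<rparr>"

definition add_universal :: "'a \<Rightarrow> 'a pair_pre_digraph \<Rightarrow> 'a pair_pre_digraph" where
  "add_universal v G =
     \<lparr> pverts = insert v (pverts G),
       parcs = parcs G \<union> {v} \<times> pverts G \<union> pverts G \<times> {v} \<rparr>"

text \<open>
  \<open>threshold_graph_with G k\<close>: \<open>G\<close> has a threshold construction in which exactly \<open>k\<close> of the additions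
  are additions of a universal vertex. The initial vertex is not counted.
\<close>

inductive threshold_graph_with :: "'a pair_pre_digraph \<Rightarrow> nat \<Rightarrow> bool" where
  single: "threshold_graph_with \<lparr> pverts = {v}, parcs = {} \<rparr> 0"
| isolated: "threshold_graph_with G k \<Longrightarrow> v \<notin> pverts G \<Longrightarrow>
    threshold_graph_with (add_isolated v G) k"
| universal: "threshold_graph_with G k \<Longrightarrow> v \<notin> pverts G \<Longrightarrow>
    threshold_graph_with (add_universal v G) (Suc k)"

lemma complete_graph_complete_digraph: "complete_digraph r (with_proj (complete_graph r))"
  by (auto simp: complete_digraph_pair_def complete_graph_def)

lemma pair_graphI:
  assumes "finite (pverts G)" "parcs G \<subseteq> pverts G \<times> pverts G" "sym (parcs G)" "irrefl (parcs G)"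
  shows "pair_graph G"
proof -
  have "finite (parcs G)"
    using assms(1,2) finite_subset by blast
  with assms show ?thesis
    by unfold_locales (auto simp: symmetric_def irrefl_def)
qed

lemma pair_graph_reconf_graph:
  assumes "pair_graph G"
  shows "pair_graph (reconf_graph G)"
proof (rule pair_graphI)
  interpret pair_graph G by fact
  have "pverts (reconf_graph G) \<subseteq> Pow (pverts G)"
    by (auto simp: reconf_graph_def minimal_dominating_set_def dominating_set_def)
  then show "finite (pverts (reconf_graph G))"
    using pair_finite_verts finite_subset by blast
  show "sym (parcs (reconf_graph G))"
    by (rule symI) (auto simp: reconf_graph_def reconf_adj_def)
qed (auto simp: reconf_graph_def reconf_adj_def irrefl_def)

lemma threshold_graph_with_pair_graph:
  "threshold_graph_with G k \<Longrightarrow> pair_graph G"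
proof (induction rule: threshold_graph_with.induct)
  case (single v)
  show ?case by (rule pair_graphI) (auto simp: sym_def irrefl_def)
next
  case (isolated G k v)
  interpret pair_graph G by fact
  have "sym (parcs G)" using pair_sym_arcs by (simp add: symmetric_def)
  moreover have "(a, a) \<notin> parcs G" for a using pair_no_loops[of "(a, a)"] by auto
  ultimately show ?case
    using pair_finite_verts
    by (intro pair_graphI) (auto simp: add_isolated_def irrefl_def dest: wellformed')
next
  case (universal G k v)
  interpret pair_graph G by fact
  have "sym (parcs G)" using pair_sym_arcs by (simp add: symmetric_def)
  moreover have "(a, a) \<notin> parcs G" for a using pair_no_loops[of "(a, a)"] by auto
  ultimately show ?case
    using pair_finite_verts universal(2)
    by (intro pair_graphI) (auto simp: add_universal_def irrefl_def sym_def dest: wellformed')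
qed

end

theory Submission
  imports Defs
begin

text \<open>
  An isolated vertex lies in every minimal dominating set, so adding one does not change the
  reconfiguration graph; adding a universal vertex \<open>v\<close> adds the single minimal dominating set \<open>{v}\<close>,
  which is adjacent to all others. Conversely, in a graph without isolated vertices the complement
  of a minimal dominating set \<open>M\<close> is dominating (Ore) and so contains a minimal dominating set
  \<open>M'\<close>. If \<open>M\<close> and \<open>M'\<close> are adjacent, one of these disjoint sets is a singleton, that is, a universal
  vertex. So a graph whose reconfiguration graph is complete always has an isolated or a universal
  vertex, which can be removed.
\<close>

section \<open>Completeness of the reconfiguration graph\<close>

definition reconf_clique :: "'a pair_pre_digraph \<Rightarrow> bool" where
  "reconf_clique G \<longleftrightarrow>
     (\<forall>A B. minimal_dominating_set G A \<and> minimal_dominating_set G B \<and> A \<noteq> B \<longrightarrow> reconf_adj G A B)"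

lemma digraph_iso_complete_graph_iff:
  assumes "pair_graph H"
  shows "digraph_iso (with_proj H) (with_proj (complete_graph r)) \<longleftrightarrow>
         card (pverts H) = r \<and> (\<forall>u\<in>pverts H. \<forall>v\<in>pverts H. u \<noteq> v \<longrightarrow> (u, v) \<in> parcs H)"
    (is "?iso \<longleftrightarrow> ?complete")
proof
  interpret pair_graph H by fact
  assume ?iso
  then obtain f where
    f: "pre_digraph.digraph_isomorphism (with_proj H) f"
    and app: "with_proj (complete_graph r) = app_iso f (with_proj H)"
    by (auto simp: digraph_iso_def)
  note f = f[unfolded pre_digraph.digraph_isomorphism_def, simplified]
  have verts: "iso_verts f ` pverts H = {..<r}"
    using arg_cong[OF app, of verts] by (simp add: complete_graph_def)
  have arcs: "iso_arcs f ` parcs H = {(i, j). i < r \<and> j < r \<and> i \<noteq> j}"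
    using arg_cong[OF app, of arcs] by (simp add: complete_graph_def)
  \<comment> \<open>The target has \<open>fst\<close> and \<open>snd\<close> as its tail and head
    maps, so \<open>iso_arcs f\<close> must act on each arc through its two endpoints.\<close>
  have proj: "iso_tail f = fst" "iso_head f = snd"
    using arg_cong[OF app, of tail] arg_cong[OF app, of head] by simp_all
  have inj: "inj_on (iso_verts f) (pverts H)"
    using f by blast
  have "card (pverts H) = r"
    using card_image[OF inj] verts by simp
  moreover have "(u, v) \<in> parcs H" if uv: "u \<in> pverts H" "v \<in> pverts H" "u \<noteq> v" for u v
  proof -
    have "(iso_verts f u, iso_verts f v) \<in> iso_arcs f ` parcs H"
      using uv verts inj by (auto simp: arcs inj_on_eq_iff)
    then obtain a where a: "a \<in> parcs H" "iso_arcs f a = (iso_verts f u, iso_verts f v)"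
      by auto
    have "iso_verts f (fst a) = iso_verts f u" "iso_verts f (snd a) = iso_verts f v"
      using f a proj by auto
    then have "fst a = u" "snd a = v"
      using inj uv a(1) arc_fst_in_verts arc_snd_in_verts by (auto dest: inj_onD)
    with a(1) show ?thesis by auto
  qed
  ultimately show ?complete by blast
next
  interpret pair_graph H by fact
  assume complete: ?complete
  then obtain f where f: "bij_betw f (pverts H) {..<r}"
    using ex_bij_betw_finite_nat[OF pair_finite_verts] by (auto simp: atLeast0LessThan)
  then have inj: "inj_on f (pverts H)" and img: "f ` pverts H = {..<r}"
    by (auto simp: bij_betw_def)
  have "(a, a) \<notin> parcs H" for a using pair_no_loops[of "(a, a)"] by auto
  then have parcs: "parcs H = {(u, v). u \<in> pverts H \<and> v \<in> pverts H \<and> u \<noteq> v}"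
    using complete by (auto dest: wellformed')
  \<comment> \<open>Any bijection of the vertices works, with arcs mapped along their endpoints,
    since all pairs of distinct vertices are arcs on both sides.\<close>
  let ?f = "\<lparr> iso_verts = f, iso_arcs = map_prod f f, iso_head = snd, iso_tail = fst \<rparr>"
  have "inj_on (map_prod f f) (parcs H)"
    using inj by (auto simp: parcs inj_on_def)
  then have "pre_digraph.digraph_isomorphism (with_proj H) ?f"
    using inj wf_digraph_axioms by (auto simp: pre_digraph.digraph_isomorphism_def)
  moreover have "map_prod f f ` parcs H = {(i, j). i < r \<and> j < r \<and> i \<noteq> j}"
  proof
    show "map_prod f f ` parcs H \<subseteq> {(i, j). i < r \<and> j < r \<and> i \<noteq> j}"
      using inj img by (auto simp: parcs inj_on_eq_iff)
    show "{(i, j). i < r \<and> j < r \<and> i \<noteq> j} \<subseteq> map_prod f f ` parcs H"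
    proof clarify
      fix i j assume "i < r" "j < r" "i \<noteq> j"
      moreover from this obtain u v where "u \<in> pverts H" "v \<in> pverts H" "i = f u" "j = f v"
        using img by (metis imageE lessThan_iff)
      ultimately show "(i, j) \<in> map_prod f f ` parcs H"
        by (auto simp: parcs intro!: rev_image_eqI[of "(u, v)"])
    qed
  qed
  then have "with_proj (complete_graph r) = app_iso ?f (with_proj H)"
    using img by (simp add: app_iso_def with_proj_def complete_graph_def)
  ultimately show ?iso
    by (auto simp: digraph_iso_def)
qed

text \<open>Separates the count from completeness: adding an isolated or universal vertex preserves
  completeness, while only a universal one changes the count.\<close>

lemma digraph_iso_reconf_complete_iff:
  assumes "pair_graph G"
  shows "digraph_iso (with_proj (reconf_graph G)) (with_proj (complete_graph r)) \<longleftrightarrow>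
         card {M. minimal_dominating_set G M} = r \<and> reconf_clique G"
  unfolding digraph_iso_complete_graph_iff[OF pair_graph_reconf_graph[OF assms]]
  by (auto simp: reconf_graph_def reconf_clique_def)

section \<open>Minimal dominating sets after adding a vertex\<close>

lemma minimal_dominating_subset:
  assumes "pair_graph G" "dominating_set G S"
  shows "\<exists>M\<subseteq>S. minimal_dominating_set G M"
proof -
  interpret pair_graph G by fact
  have "finite S"
    using assms(2) finite_subset[OF _ pair_finite_verts] by (auto simp: dominating_set_def)
  then show ?thesis
    using assms(2)
  proof (induction S rule: finite_psubset_induct)
    case (psubset S)
    then show ?case
      unfolding minimal_dominating_set_def by (meson order.trans order_refl psubset_imp_subset)
  qed
qed

text \<open>Only \<open>v\<close> can dominate \<open>v\<close>, and it dominates nothing else, so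
  the rest of \<open>S\<close> has to dominate \<open>G\<close>.\<close>

lemma dominating_set_add_isolated_iff:
  assumes "pair_graph G" "v \<notin> pverts G"
  shows "dominating_set (add_isolated v G) S \<longleftrightarrow> v \<in> S \<and> dominating_set G (S - {v})"
proof -
  interpret pair_graph G by fact
  show ?thesis
    using assms(2)
    by (auto simp: dominating_set_def add_isolated_def open_nbhd_def dest: wellformed')
qed

lemma dominating_set_add_universal_iff:
  assumes "pair_graph G" "v \<notin> pverts G" "pverts G \<noteq> {}"
  shows "dominating_set (add_universal v G) S \<longleftrightarrow>
         S \<subseteq> insert v (pverts G) \<and> (v \<in> S \<or> dominating_set G S)"
proof -
  interpret pair_graph G by fact
  show ?thesis
  proof (cases "v \<in> S")
    case True
    then show ?thesis
      by (auto simp: dominating_set_def add_universal_def open_nbhd_def)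
  next
    case False
    then have "dominating_set G S" if "dominating_set (add_universal v G) S"
      using that assms(2) by (fastforce simp: dominating_set_def add_universal_def open_nbhd_def)
    moreover have "dominating_set (add_universal v G) S" if dom: "dominating_set G S"
    proof -
      \<comment> \<open>A set that dominates a nonempty graph has an element, and this element
        dominates \<open>v\<close>. For empty \<open>G\<close> the empty set would break the
        equivalence.\<close>
      obtain s where "s \<in> S"
        using dom assms(3) by (auto simp: dominating_set_def)
      with dom show ?thesis
        by (fastforce simp: dominating_set_def add_universal_def open_nbhd_def)
    qed
    moreover have "S \<subseteq> pverts G" if "dominating_set G S"
      using that by (simp add: dominating_set_def)
    ultimately show ?thesis
      using False by blast
  qed
qed

text \<open>\<open>insert v\<close> is an inclusion-preserving bijection from the dominating sets of
  \<open>G\<close> onto those of the larger graph, with inverse removal of \<open>v\<close>, so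
  minimality transfers.\<close>

lemma minimal_dominating_sets_add_isolated:
  assumes "pair_graph G" "v \<notin> pverts G"
  shows "{M. minimal_dominating_set (add_isolated v G) M} =
         insert v ` {M. minimal_dominating_set G M}"
proof -
  note dom = dominating_set_add_isolated_iff[OF assms]
  have notin: "v \<notin> M" if "dominating_set G M" for M
    using that assms(2) by (auto simp: dominating_set_def)
  have "minimal_dominating_set (add_isolated v G) (insert v M)"
    if "minimal_dominating_set G M" for M
  proof -
    have "v \<notin> M"
      using notin that by (auto simp: minimal_dominating_set_def)
    then have "T - {v} \<subset> M" if "T \<subset> insert v M" "v \<in> T" for T
      using that by auto
    with \<open>v \<notin> M\<close> that show ?thesis
      by (auto simp: minimal_dominating_set_def dom)
  qed
  moreover have "M \<in> insert v ` {M. minimal_dominating_set G M}"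
    if min: "minimal_dominating_set (add_isolated v G) M" for M
  proof (rule rev_image_eqI)
    have "v \<in> M" "dominating_set G (M - {v})"
      using min by (auto simp: minimal_dominating_set_def dom)
    then show "M = insert v (M - {v})"
      by auto
    have "\<not> dominating_set G T" if "T \<subset> M - {v}" for T
    proof
      assume "dominating_set G T"
      then have "dominating_set (add_isolated v G) (insert v T)"
        using notin by (simp add: dom)
      moreover have "insert v T \<subset> M"
        using that \<open>v \<in> M\<close> by auto
      ultimately show False
        using min by (auto simp: minimal_dominating_set_def)
    qed
    with \<open>dominating_set G (M - {v})\<close> show "M - {v} \<in> {M. minimal_dominating_set G M}"
      by (simp add: minimal_dominating_set_def)
  qed
  ultimately show ?thesis by blast
qed

text \<open>Since \<open>{v}\<close> dominates, it is the only minimal set that can contain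
  \<open>v\<close>. Subsets of a set avoiding \<open>v\<close> avoid it too, so for such sets
  minimality means the same in both graphs.\<close>

lemma minimal_dominating_sets_add_universal:
  assumes "pair_graph G" "v \<notin> pverts G" "pverts G \<noteq> {}"
  shows "{M. minimal_dominating_set (add_universal v G) M} =
         insert {v} {M. minimal_dominating_set G M}"
proof -
  note dom = dominating_set_add_universal_iff[OF assms]
  have sub: "M \<subseteq> pverts G" if "dominating_set G M" for M
    using that by (simp add: dominating_set_def)
  have "\<not> dominating_set G {}"
    using assms(3) by (auto simp: dominating_set_def)
  then have "minimal_dominating_set (add_universal v G) {v}"
    by (auto simp: minimal_dominating_set_def dom psubset_eq subset_singleton_iff)
  moreover have "minimal_dominating_set (add_universal v G) M"
    if "minimal_dominating_set G M" for M
    using that sub assms(2) unfolding minimal_dominating_set_def dom by blast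
  moreover have "M = {v} \<or> minimal_dominating_set G M"
    if min: "minimal_dominating_set (add_universal v G) M" for M
  proof (cases "v \<in> M")
    case True
    have "dominating_set (add_universal v G) {v}"
      by (simp add: dom)
    with min True have "\<not> {v} \<subset> M"
      by (auto simp: minimal_dominating_set_def)
    with True show ?thesis by auto
  next
    case False
    then show ?thesis
      using min sub unfolding minimal_dominating_set_def dom by blast
  qed
  ultimately show ?thesis by blast
qed

section \<open>Completeness is invariant under both kinds of addition\<close>

lemma reconf_clique_add_isolated_iff:
  assumes "pair_graph G" "v \<notin> pverts G"
  shows "reconf_clique (add_isolated v G) \<longleftrightarrow> reconf_clique G"
proof -
  have min: "minimal_dominating_set (add_isolated v G) M \<longleftrightarrow>
      (\<exists>A. minimal_dominating_set G A \<and> M = insert v A)" for M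
    using minimal_dominating_sets_add_isolated[OF assms] by blast
  have notin: "v \<notin> A" if "minimal_dominating_set G A" for A
    using that assms(2) by (auto simp: minimal_dominating_set_def dominating_set_def)
  have adj: "reconf_adj (add_isolated v G) (insert v A) (insert v B) \<longleftrightarrow> reconf_adj G A B"
    if "v \<notin> A" "v \<notin> B" for A B
  proof -
    \<comment> \<open>Adjacency depends only on the two set differences and on neighbourhoods; the
      common element \<open>v\<close> cancels from the former and leaves the latter
      unchanged.\<close>
    have "insert v A - insert v B = A - B" "insert v B - insert v A = B - A"
      using that by auto
    then show ?thesis
      by (simp add: reconf_adj_def open_nbhd_def add_isolated_def)
  qed
  have "insert v A = insert v B \<longleftrightarrow> A = B" if "v \<notin> A" "v \<notin> B" for A B
    using that by (simp add: insert_ident)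
  with notin adj show ?thesis
    unfolding reconf_clique_def min by metis
qed

text \<open>Neighbourhoods of old vertices grow only by \<open>v\<close>, which lies in no old
  minimal dominating set, so old adjacencies are unaffected. The new set \<open>{v}\<close> is
  adjacent to every old one because \<open>v\<close> is universal.\<close>

lemma reconf_clique_add_universal_iff:
  assumes "pair_graph G" "v \<notin> pverts G" "pverts G \<noteq> {}"
  shows "reconf_clique (add_universal v G) \<longleftrightarrow> reconf_clique G"
proof -
  have min: "minimal_dominating_set (add_universal v G) M \<longleftrightarrow>
      M = {v} \<or> minimal_dominating_set G M" for M
    using minimal_dominating_sets_add_universal[OF assms] by blast
  have sub: "A \<subseteq> pverts G" if "minimal_dominating_set G A" for A
    using that by (auto simp: minimal_dominating_set_def dominating_set_def)
  have nbhd: "open_nbhd (add_universal v G) x = insert v (open_nbhd G x)" if "x \<in> pverts G" for x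
    using that assms(2) by (auto simp: open_nbhd_def add_universal_def)
  have adj: "reconf_adj (add_universal v G) A B \<longleftrightarrow> reconf_adj G A B"
    if "A \<subseteq> pverts G" "B \<subseteq> pverts G" for A B
  proof -
    have "A - B \<subseteq> open_nbhd (add_universal v G) x \<longleftrightarrow> A - B \<subseteq> open_nbhd G x"
      "B - A \<subseteq> open_nbhd (add_universal v G) x \<longleftrightarrow> B - A \<subseteq> open_nbhd G x"
      if "x \<in> pverts G" for x
      using \<open>A \<subseteq> pverts G\<close> \<open>B \<subseteq> pverts G\<close> assms(2) by (auto simp: nbhd[OF that])
    \<comment> \<open>The vertex witnessing adjacency comes from one of the two sets, so it differs
      from \<open>v\<close> and the comparison of neighbourhoods applies to it.\<close>
    moreover have "x \<in> pverts G" if "A - B = {x} \<or> B - A = {x}" for x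
      using that \<open>A \<subseteq> pverts G\<close> \<open>B \<subseteq> pverts G\<close> by blast
    ultimately show ?thesis
      unfolding reconf_adj_def by metis
  qed
  have "reconf_adj (add_universal v G) {v} B" "reconf_adj (add_universal v G) B {v}"
    if "B \<subseteq> pverts G" for B
  proof -
    have "{v} - B = {v}" "B - {v} \<subseteq> open_nbhd (add_universal v G) v"
      using that assms(2) by (auto simp: open_nbhd_def add_universal_def)
    then show "reconf_adj (add_universal v G) {v} B" "reconf_adj (add_universal v G) B {v}"
      unfolding reconf_adj_def by blast+
  qed
  with sub adj show ?thesis
    unfolding reconf_clique_def min by metis
qed

section \<open>From a threshold construction to a complete reconfiguration graph\<close>

lemma threshold_graph_with_nonempty: "threshold_graph_with G k \<Longrightarrow> pverts G \<noteq> {}"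
  by (induction rule: threshold_graph_with.induct) (auto simp: add_isolated_def add_universal_def)

lemma minimal_dominating_set_single:
  "minimal_dominating_set \<lparr> pverts = {v}, parcs = {} \<rparr> M \<longleftrightarrow> M = {v}"
  by (auto simp: minimal_dominating_set_def dominating_set_def open_nbhd_def)

text \<open>The initial vertex gives one minimal dominating set and each universal addition one
  more, hence \<open>Suc k\<close>.\<close>

lemma threshold_graph_with_reconf:
  assumes "threshold_graph_with G k"
  shows "reconf_clique G \<and> card {M. minimal_dominating_set G M} = Suc k"
  using assms
proof (induction rule: threshold_graph_with.induct)
  case (single v)
  then show ?case
    by (simp add: reconf_clique_def minimal_dominating_set_single)
next
  case (isolated G k v)
  have G: "pair_graph G"
    using isolated.hyps(1) by (rule threshold_graph_with_pair_graph)
  have "v \<notin> M" if "minimal_dominating_set G M" for M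
    using that isolated.hyps(2) by (auto simp: minimal_dominating_set_def dominating_set_def)
  then have "inj_on (insert v) {M. minimal_dominating_set G M}"
    by (auto simp: inj_on_def insert_ident)
  with isolated show ?case
    by (simp add: minimal_dominating_sets_add_isolated[OF G] reconf_clique_add_isolated_iff[OF G]
        card_image)
next
  case (universal G k v)
  have G: "pair_graph G"
    using universal.hyps(1) by (rule threshold_graph_with_pair_graph)
  have ne: "pverts G \<noteq> {}"
    using universal.hyps(1) by (rule threshold_graph_with_nonempty)
  \<comment> \<open>Finiteness is read off from the positive cardinality \<open>Suc k\<close>; it
    lets \<open>card\<close> count the inserted set \<open>{v}\<close>.\<close>
  have "finite {M. minimal_dominating_set G M}"
    using universal.IH card_ge_0_finite by force
  moreover have "\<not> minimal_dominating_set G {v}"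
    using universal.hyps(2) by (auto simp: minimal_dominating_set_def dominating_set_def)
  ultimately show ?case
    using universal ne
    by (simp add: minimal_dominating_sets_add_universal[OF G] reconf_clique_add_universal_iff[OF G])
qed

section \<open>From a complete reconfiguration graph to a threshold construction\<close>

lemma dominating_set_complement:
  assumes "pair_graph G" "minimal_dominating_set G M"
    and no_isolated: "\<And>v. v \<in> pverts G \<Longrightarrow> open_nbhd G v \<noteq> {}"
  shows "dominating_set G (pverts G - M)"
proof -
  interpret pair_graph G by fact
  have sym: "(y, x) \<in> parcs G" if "(x, y) \<in> parcs G" for x y
    using pair_sym_arcs that by (auto simp: symmetric_def sym_def)
  have dom: "dominating_set G M" and min: "\<And>T. T \<subset> M \<Longrightarrow> \<not> dominating_set G T"
    using assms(2) by (auto simp: minimal_dominating_set_def)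
  have "\<exists>u\<in>pverts G - M. v \<in> open_nbhd G u" if v: "v \<in> M" "v \<in> pverts G" for v
  \<comment> \<open>If all neighbours of \<open>v\<close> lie in \<open>M\<close>, then
    \<open>M - {v}\<close> still dominates: a neighbour \<open>w\<close> covers \<open>v\<close>,
    and every vertex that \<open>v\<close> covered is itself in \<open>M\<close>.\<close>
  proof (rule ccontr)
    assume none: "\<not> ?thesis"
    obtain w where w: "(v, w) \<in> parcs G"
      using no_isolated[OF v(2)] by (auto simp: open_nbhd_def)
    have inside: "u \<in> M" if "(v, u) \<in> parcs G" for u
      using none that sym by (auto simp: open_nbhd_def dest: wellformed')
    have "w \<noteq> v"
      using w pair_no_loops by fastforce
    have "x \<in> M - {v} \<or> (\<exists>u\<in>M - {v}. x \<in> open_nbhd G u)" if x: "x \<in> pverts G" for x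
    proof (cases "x = v")
      case True
      then show ?thesis
        using w inside[OF w] \<open>w \<noteq> v\<close> sym by (auto simp: open_nbhd_def)
    next
      case False
      then show ?thesis
        using dom x inside by (auto simp: dominating_set_def open_nbhd_def)
    qed
    then have "dominating_set G (M - {v})"
      using dom by (auto simp: dominating_set_def)
    moreover have "M - {v} \<subset> M"
      using v by auto
    ultimately show False
      using min by blast
  qed
  then show ?thesis
    by (auto simp: dominating_set_def)
qed

lemma reconf_clique_isolated_or_universal:
  assumes "pair_graph G" "pverts G \<noteq> {}" "reconf_clique G"
  shows "(\<exists>v\<in>pverts G. open_nbhd G v = {}) \<or> (\<exists>v\<in>pverts G. pverts G - {v} \<subseteq> open_nbhd G v)"
proof (cases "\<exists>v\<in>pverts G. open_nbhd G v = {}")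
  case False
  then have no_isolated: "\<And>v. v \<in> pverts G \<Longrightarrow> open_nbhd G v \<noteq> {}"
    by blast
  have "dominating_set G (pverts G)"
    by (auto simp: dominating_set_def)
  then obtain A where A: "minimal_dominating_set G A"
    using minimal_dominating_subset[OF assms(1)] by blast
  then obtain B where B: "B \<subseteq> pverts G - A" "minimal_dominating_set G B"
    using minimal_dominating_subset[OF assms(1) dominating_set_complement[OF assms(1) _ no_isolated]]
    by blast
  have "A \<noteq> {}"
    using A assms(2) by (auto simp: minimal_dominating_set_def dominating_set_def)
  then have "A \<noteq> B"
    using B by blast
  then have "reconf_adj G A B"
    using assms(3) A B by (auto simp: reconf_clique_def)
  \<comment> \<open>Disjointness turns the differences in \<open>reconf_adj\<close> into the whole
    sets, so one of them is a singleton.\<close>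
  moreover have "A - B = A" "B - A = B"
    using B by auto
  ultimately obtain v where "A = {v} \<or> B = {v}"
    by (auto simp: reconf_adj_def)
  then have "dominating_set G {v}"
    using A B by (auto simp: minimal_dominating_set_def)
  then show ?thesis
    by (auto simp: dominating_set_def)
qed simp

text \<open>Strong induction on the number of vertices. The value of \<open>k\<close> may stay open,
  since counting minimal dominating sets determines it afterwards.\<close>

lemma reconf_clique_imp_threshold:
  assumes "pair_graph G" "pverts G \<noteq> {}" "reconf_clique G"
  shows "\<exists>k. threshold_graph_with G k"
  using assms
proof (induction "card (pverts G)" arbitrary: G rule: less_induct)
  case less
  interpret pair_graph G by (rule less.prems)
  have sym: "(y, x) \<in> parcs G" if "(x, y) \<in> parcs G" for x y
    using pair_sym_arcs that by (auto simp: symmetric_def sym_def)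
  have irrefl: "(x, x) \<notin> parcs G" for x
    using pair_no_loops[of "(x, x)"] by auto
  from reconf_clique_isolated_or_universal[OF less.prems]
  obtain v where v: "v \<in> pverts G"
    and cases: "open_nbhd G v = {} \<or> pverts G - {v} \<subseteq> open_nbhd G v"
    by blast
  \<comment> \<open>The subgraph induced by the vertices other than \<open>v\<close>.\<close>
  define H where "H = \<lparr> pverts = pverts G - {v},
    parcs = parcs G \<inter> (pverts G - {v}) \<times> (pverts G - {v}) \<rparr>"
  have H: "pair_graph H"
    using pair_finite_verts sym irrefl
    by (intro pair_graphI) (auto simp: H_def sym_def irrefl_def)
  have vH: "v \<notin> pverts H"
    by (simp add: H_def)
  have smaller: "card (pverts H) < card (pverts G)"
    using card_Diff1_less[OF pair_finite_verts v] by (simp add: H_def)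
  have G_eq: "G = add_isolated v H \<or> G = add_universal v H"
    using cases
  proof
    assume "open_nbhd G v = {}"
    then have "(v, x) \<notin> parcs G" "(x, v) \<notin> parcs G" for x
      using sym[of x v] by (auto simp: open_nbhd_def)
    then have "parcs G = parcs H"
      by (auto simp: H_def open_nbhd_def dest: wellformed')
    then have "G = add_isolated v H"
      using v by (intro pair_pre_digraph.equality) (auto simp: add_isolated_def H_def)
    then show ?thesis ..
  next
    assume univ: "pverts G - {v} \<subseteq> open_nbhd G v"
    then have "(v, x) \<in> parcs G" "(x, v) \<in> parcs G" if "x \<in> pverts G - {v}" for x
      using that sym[of v x] by (auto simp: open_nbhd_def)
    then have "parcs G = parcs H \<union> {v} \<times> pverts H \<union> pverts H \<times> {v}"
      using irrefl by (auto simp: H_def dest: wellformed')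
    then have "G = add_universal v H"
      using v by (intro pair_pre_digraph.equality) (auto simp: add_universal_def H_def)
    then show ?thesis ..
  qed
  show ?case
  \<comment> \<open>Constructions start from one vertex, so the single-vertex graph is the base
    case, with \<open>k = 0\<close>; it does not arise by an addition to the empty graph.\<close>
  proof (cases "pverts H = {}")
    case True
    then have "pverts G = {v}" "parcs G = {}"
      using v irrefl by (auto simp: H_def dest: wellformed')
    then have "G = \<lparr> pverts = {v}, parcs = {} \<rparr>"
      by (intro pair_pre_digraph.equality) auto
    then show ?thesis
      using threshold_graph_with.single by metis
  next
    case False
    have "reconf_clique H"
      using G_eq less.prems(3) reconf_clique_add_isolated_iff[OF H vH]
        reconf_clique_add_universal_iff[OF H vH False] by auto
    then obtain k where "threshold_graph_with H k"
      using less.hyps[OF smaller H False] by blast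
    then show ?thesis
      using G_eq threshold_graph_with.isolated[OF _ vH] threshold_graph_with.universal[OF _ vH]
      by metis
  qed
qed

theorem theorem8:
  fixes G :: "'a pair_pre_digraph" and r :: nat
  assumes "pair_graph G" and "pverts G \<noteq> {}" and "r > 0"
  shows "digraph_iso (with_proj (reconf_graph G)) (with_proj (complete_graph r)) \<longleftrightarrow>
         threshold_graph_with G (r - 1)"
proof
  assume "digraph_iso (with_proj (reconf_graph G)) (with_proj (complete_graph r))"
  then have r: "card {M. minimal_dominating_set G M} = r" and "reconf_clique G"
    using digraph_iso_reconf_complete_iff[OF assms(1)] by auto
  then obtain k where k: "threshold_graph_with G k"
    using reconf_clique_imp_threshold[OF assms(1,2)] by blast
  \<comment> \<open>Every construction of \<open>G\<close> with \<open>k\<close> universal additions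
    yields \<open>Suc k\<close> minimal dominating sets, and there are \<open>r\<close> of
    them.\<close>
  then have "r = Suc k"
    using r threshold_graph_with_reconf by blast
  with k show "threshold_graph_with G (r - 1)"
    by simp
next
  assume "threshold_graph_with G (r - 1)"
  \<comment> \<open>Positivity of \<open>r\<close> turns the count \<open>Suc (r - 1)\<close> into
    \<open>r\<close>.\<close>
  then show "digraph_iso (with_proj (reconf_graph G)) (with_proj (complete_graph r))"
    using threshold_graph_with_reconf assms(3)
    by (auto simp: digraph_iso_reconf_complete_iff[OF assms(1)])
qed

end
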